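(* Let $d\ge 1$ and let $P$ be a $d$-dimensional polytope in Euclidean space $E^d$, with inradius $g$. The inner neighborhood volume function $V_P$ is a diphase Steiner-like function (of degree $d$) of class $\mathcal{C}^{d-1}$ on $[0,+\infty)$ if and only if $P$ admits an inscribed $d$-dimensional Euclidean ball. Moreover, in this case the coefficients $\kappa_i(P)$ of $V_P$ satisfy $$\kappa_i(P)=(-1)^{d-i-1}\binom{d}{i}\frac{\mathrm{vol}_d(P)}{g^{d-i}}\qquad\text{for all } i=0,1,\dots,d-1 .$$
   Context: A $d$-dimensional polytope in $E^d$ is a compact convex set with non-empty interior that is the intersection of finitely many closed half-spaces. If $\{\mathcal{H}_1,\dots,\mathcal{H}_m\}$ is a minimal collection of closed half-spaces whose intersection is $P$, the facets of $P$ are the sets $F_j=P\cap\partial\mathcal{H}_j$. For $r\ge 0$, $P(r)=\{Q\in P : \mathrm{d}(Q,\partial P)\ge r\}$ is the $r$-interior of $P$, and the inner neighborhood volume function is $V_P(r)=\mathrm{vol}_d(P\setminus P(r))$. The inradius $g$ of $P$ is the maximum $g>0$ such that $P$ contains a ball of radius $g$. An inscribed ball of $P$ is a ball contained in $P$ and tangent to all the facets of $P$. A degree $d$ pluri-phase Steiner-like function is a continuous function $\varphi:[0,+\infty)\to[0,+\infty)$ for which there are finitely many numbers $0=g_0<g_1<\dots<g_{m-1}<+\infty$ such that on each $[g_{i-1},g_i]$, $1\le i\le m-1$, $\varphi$ is a polynomial $\varphi(r)=\sum_{k=0}^d\kappa_{d-k,i}r^k$ with real coefficients (the leading coefficient is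 not required to be nonzero), and $\varphi$ is constant on $[g_{m-1},+\infty)$. If $m=2$, $\varphi$ is called a diphase Steiner-like function, and the coefficient $\kappa_{d-k,1}$ of $r^k$ on $[0,g_1]$ is denoted $\kappa_{d-k}$; so for $V_P$ diphase, $\kappa_i(P)$ is the coefficient of $r^{d-i}$ in the polynomial that $V_P$ equals on $[0,g_1]$. Differentiability at $0$ is one-sided. *)

theory Defs
  imports "HOL-Analysis.Analysis"
begin

definition full_polytope :: "'a::euclidean_space set \<Rightarrow> bool" where
  "full_polytope P \<longleftrightarrow> compact P \<and> convex P \<and> interior P \<noteq> {} \<and> polyhedron P"

text \<open>Facets are rendered by the library's \<^const>\<open>facet_of\<close>. For full-dimensional polyhedra
  these are exactly the sets cut out by the boundary hyperplanes of a minimal family of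
  closed half-spaces:\<close>

lemma facets_minimal_halfspaces:
  fixes P :: "'a::euclidean_space set"
  assumes int: "interior P \<noteq> {}"
    and fin: "finite Hs"
    and hs: "\<And>h. h \<in> Hs \<Longrightarrow> \<exists>a b. a \<noteq> 0 \<and> h = {x. a \<bullet> x \<le> b}"
    and P: "P = \<Inter>Hs"
    and min: "\<And>Hs'. Hs' \<subset> Hs \<Longrightarrow> \<Inter>Hs' \<noteq> P"
  shows "{F. F facet_of P} = (\<lambda>h. P \<inter> frontier h) ` Hs"
proof -
  obtain a b where ab: "\<And>h. h \<in> Hs \<Longrightarrow> a h \<noteq> 0 \<and> h = {x. a h \<bullet> x \<le> b h}"
    using hs by metis
  have aff: "affine hull P = UNIV"
    using int by (rule affine_hull_nonempty_interior)
  have psub: "P \<subset> affine hull P \<inter> \<Inter>Hs'" if "Hs' \<subset> Hs" for Hs'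
    using min[OF that] that P aff by auto
  have fr: "frontier h = {x. a h \<bullet> x = b h}" if "h \<in> Hs" for h
    using ab[OF that] frontier_halfspace_le by metis
  have "F facet_of P \<longleftrightarrow> (\<exists>h. h \<in> Hs \<and> F = P \<inter> {x. a h \<bullet> x = b h})" for F
    by (rule facet_of_polyhedron_explicit[OF fin _ ab psub]) (use P aff in auto)
  then show ?thesis
    using fr by auto
qed

definition r_interior :: "'a::euclidean_space set \<Rightarrow> real \<Rightarrow> 'a set" where
  "r_interior P r = {Q \<in> P. infdist Q (frontier P) \<ge> r}"

definition inner_nbhd_volume :: "'a::euclidean_space set \<Rightarrow> real \<Rightarrow> real" where
  "inner_nbhd_volume P r = measure lebesgue (P - r_interior P r)"

definition inradius :: "'a::euclidean_space set \<Rightarrow> real" where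
  "inradius P = (GREATEST g. g > 0 \<and> (\<exists>c. cball c g \<subseteq> P))"

text \<open>The sphere meets the hyperplane spanned by the facet in exactly one point, and that point
  lies on the facet itself. Using the sphere rather than the ball keeps this correct in dimension
  one, where the hyperplane is a single point.\<close>

definition tangent_to_facet :: "'a::euclidean_space \<Rightarrow> real \<Rightarrow> 'a set \<Rightarrow> bool" where
  "tangent_to_facet c \<rho> F \<longleftrightarrow> (\<exists>x \<in> F. sphere c \<rho> \<inter> affine hull F = {x})"

definition inscribed_ball :: "'a::euclidean_space set \<Rightarrow> 'a \<Rightarrow> real \<Rightarrow> bool" where
  "inscribed_ball P c \<rho> \<longleftrightarrow>
     \<rho> > 0 \<and> cball c \<rho> \<subseteq> P \<and> (\<forall>F. F facet_of P \<longrightarrow> tangent_to_facet c \<rho> F)"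

text \<open>Functions on the half-line are total functions of which only the values on \<open>{0..}\<close> matter.
  The coefficient of \<open>r ^ k\<close> on \<open>{g (i - 1)..g i}\<close> is \<open>\<kappa> (d - k) i\<close>.\<close>

definition steiner_like_with ::
  "nat \<Rightarrow> nat \<Rightarrow> (nat \<Rightarrow> real) \<Rightarrow> (nat \<Rightarrow> nat \<Rightarrow> real) \<Rightarrow> (real \<Rightarrow> real) \<Rightarrow> bool" where
  "steiner_like_with d m g \<kappa> \<phi> \<longleftrightarrow>
     continuous_on {0..} \<phi> \<and> (\<forall>r\<ge>0. \<phi> r \<ge> 0) \<and>
     m \<ge> 1 \<and> g 0 = 0 \<and> (\<forall>i\<in>{1..m-1}. g (i - 1) < g i) \<and>
     (\<forall>i\<in>{1..m-1}. \<forall>r\<in>{g (i - 1)..g i}. \<phi> r = (\<Sum>k\<le>d. \<kappa> (d - k) i * r ^ k)) \<and>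
     (\<exists>c. \<forall>r\<ge>g (m - 1). \<phi> r = c)"

definition diphase_steiner_like :: "nat \<Rightarrow> (real \<Rightarrow> real) \<Rightarrow> bool" where
  "diphase_steiner_like d \<phi> \<longleftrightarrow> (\<exists>g \<kappa>. steiner_like_with d 2 g \<kappa> \<phi>)"

text \<open>Class \<open>C^k\<close> relative to \<open>S\<close>; the \<open>j\<close>-th derivative is \<open>D j\<close>. For \<open>S = {0..}\<close> the derivatives
  at \<open>0\<close> are one-sided.\<close>

definition Ck_on :: "nat \<Rightarrow> (real \<Rightarrow> real) \<Rightarrow> real set \<Rightarrow> bool" where
  "Ck_on k f S \<longleftrightarrow>
     (\<exists>D. D 0 = f \<and>
          (\<forall>j<k. \<forall>x\<in>S. (D j has_real_derivative D (Suc j) x) (at x within S)) \<and>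
          continuous_on S (D k))"

end

theory Submission
  imports Defs
begin

text \<open>
  Write \<open>P\<close> as the set of \<open>x\<close> with \<open>u\<^sub>i \<bullet> x \<le> \<beta>\<^sub>i\<close> for finitely many unit normals \<open>u\<^sub>i\<close>, one for each
  facet. A point has distance at least \<open>r\<close> from the boundary exactly when the ball of radius \<open>r\<close>
  around it stays in \<open>P\<close>, so \<open>P(r)\<close> is cut out by the inequalities \<open>u\<^sub>i \<bullet> x \<le> \<beta>\<^sub>i - r\<close>
  (\<open>r_interior_eq\<close>). Call \<open>\<beta>\<^sub>i - u\<^sub>i \<bullet> c\<close> the height of \<open>c\<close> over the \<open>i\<close>-th facet hyperplane. A ball with
  centre \<open>c\<close> and radius \<open>\<rho>\<close> is inscribed precisely if all heights of \<open>c\<close> equal \<open>\<rho>\<close>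
  (\<open>inscribed_ball_iff\<close>).

  If all heights equal \<open>\<rho>\<close>, then shrinking \<open>P\<close> towards \<open>c\<close> by the factor \<open>1 - r/\<rho>\<close> pushes every facet
  inwards by exactly \<open>r\<close>. So \<open>P(r)\<close> is that homothetic copy and
  \<open>V\<^sub>P(r) = vol(P) (1 - max(0, 1 - r/\<rho>)\<^sup>d)\<close>: a diphase function of class \<open>C\<^sup>d\<^sup>-\<^sup>1\<close> whose coefficients are
  read off from the binomial theorem.

  Conversely, let \<open>V\<^sub>P\<close> be diphase with break point \<open>g\<close> and of class \<open>C\<^sup>d\<^sup>-\<^sup>1\<close>. Beyond \<open>g\<close> it is
  constant, with value \<open>vol(P)\<close> because \<open>P(r)\<close> is empty for large \<open>r\<close>. A polynomial of degree at most \<open>d\<close>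
  that meets a constant at \<open>g\<close> with \<open>d - 1\<close> matching derivatives differs from it by a multiple of
  \<open>(r - g)\<^sup>d\<close>, and \<open>V\<^sub>P(0) = 0\<close> fixes the multiple, so \<open>vol(P(r)) = vol(P) (1 - r/g)\<^sup>d\<close>.
  One could now appeal to the equality case of the Brunn-Minkowski inequality, but for polytopes there
  is a more elementary way. A point \<open>c\<close> at maximal distance from the boundary is the
  centre of a ball of radius \<open>g\<close> in \<open>P\<close>, and by convexity \<open>P(t g)\<close> contains the homothetic copy
  \<open>c + (1 - t)(P - c)\<close>. Both have volume \<open>(1 - t)\<^sup>d vol(P)\<close>, so they coincide. For
  small \<open>t\<close> every facet of \<open>P\<close> survives in \<open>P(t g)\<close> at depth exactly \<open>t g\<close>, whereas in the copy the
  facet of height \<open>h\<close> has moved inwards by \<open>t h\<close>. Hence \<open>h \<le> g\<close> for every facet, and the ball around \<open>c\<close>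
  gives \<open>h \<ge> g\<close> (\<open>homothetic_r_interior_imp_equal_heights\<close>).
\<close>

section \<open>Polynomials glued smoothly to a constant\<close>

lemma poly_all_derivatives_vanish_imp_power:
  fixes q :: "real poly"
  assumes "degree q \<le> n" and "\<And>j. j < n \<Longrightarrow> poly ((pderiv ^^ j) q) a = 0"
  shows "\<exists>\<alpha>. q = smult \<alpha> ([:-a, 1:] ^ n)"
  using assms
proof (induction n arbitrary: q)
  case 0
  then obtain \<alpha> where "q = [:\<alpha>:]"
    by (metis degree_eq_zeroE le_zero_eq)
  then show ?case by auto
next
  case (Suc n)
  have "degree (pderiv q) \<le> n"
    using Suc.prems(1) by (simp add: degree_pderiv)
  moreover have "poly ((pderiv ^^ j) (pderiv q)) a = 0" if "j < n" for j
    using Suc.prems(2)[of "Suc j"] that by (simp add: funpow_swap1)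
  ultimately obtain \<alpha> where \<alpha>: "pderiv q = smult \<alpha> ([:-a, 1:] ^ n)"
    using Suc.IH by blast
  \<comment> \<open>the antiderivative that vanishes at \<open>a\<close>\<close>
  let ?s = "smult (\<alpha> / real (Suc n)) ([:-a, 1:] ^ Suc n)"
  have "pderiv ?s = smult \<alpha> ([:-a, 1:] ^ n)"
    unfolding pderiv_smult pderiv_power_Suc by (simp add: pderiv_pCons)
  then have "pderiv (q - ?s) = 0"
    by (simp add: \<alpha> pderiv_diff)
  then obtain h where h: "q - ?s = [:h:]"
    using pderiv_iszero by blast
  have "poly q a = 0"
    using Suc.prems(2)[of 0] by simp
  then have "h = 0"
    using arg_cong[OF h, of "\<lambda>p. poly p a"] by simp
  then show ?case
    using h by (intro exI[of _ "\<alpha> / real (Suc n)"]) simp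
qed

lemma higher_pderiv_diff:
  fixes p q :: "real poly"
  shows "(pderiv ^^ j) (p - q) = (pderiv ^^ j) p - (pderiv ^^ j) q"
  by (induction j) (simp_all add: pderiv_diff)

lemma Ck_derivatives_eq_on_open:
  fixes D :: "nat \<Rightarrow> real \<Rightarrow> real"
  assumes der: "\<And>j x. j < k \<Longrightarrow> x \<in> S \<Longrightarrow> (D j has_real_derivative D (Suc j) x) (at x within S)"
    and U: "open U" "U \<subseteq> S" and eq: "\<And>x. x \<in> U \<Longrightarrow> D 0 x = poly p x"
    and "j \<le> k" "x \<in> U"
  shows "D j x = poly ((pderiv ^^ j) p) x"
  using \<open>j \<le> k\<close> \<open>x \<in> U\<close>
proof (induction j arbitrary: x)
  case 0
  then show ?case using eq by simp
next
  case (Suc j)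
  have "j < k" "x \<in> S"
    using Suc.prems U(2) by auto
  from DERIV_subset[OF der[OF this] U(2)]
  have "(D j has_real_derivative D (Suc j) x) (at x)"
    unfolding at_within_open[OF Suc.prems(2) U(1)] .
  moreover have "(D j has_real_derivative poly (pderiv ((pderiv ^^ j) p)) x) (at x)"
    by (rule has_field_derivative_transform_within_open[OF poly_DERIV U(1) Suc.prems(2)])
       (use Suc.IH Suc.prems in auto)
  ultimately show ?case
    by (simp add: DERIV_unique)
qed

text \<open>Approaching the gluing point \<open>a\<close> from the left, the \<open>j\<close>-th derivative of \<open>\<phi>\<close> tends to that of the
  polynomial; approaching it from the right, it tends to that of the constant. As it is continuous at \<open>a\<close>
  for \<open>j < d\<close>, polynomial and constant agree there to order \<open>d\<close>.\<close>

lemma smooth_gluing_to_constant: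
  fixes \<phi> :: "real \<Rightarrow> real"
  assumes "degree p \<le> d" "0 < d" "0 < a"
    and left: "\<And>r. r \<in> {0..a} \<Longrightarrow> \<phi> r = poly p r"
    and right: "\<And>r. a \<le> r \<Longrightarrow> \<phi> r = c"
    and Ck: "Ck_on (d - 1) \<phi> {0..}"
  shows "\<exists>\<alpha>. \<forall>r\<in>{0..a}. \<phi> r = c + \<alpha> * (r - a) ^ d"
proof -
  obtain D where D0: "D 0 = \<phi>"
    and der: "\<And>j x. j < d - 1 \<Longrightarrow> x \<in> {0..} \<Longrightarrow> (D j has_real_derivative D (Suc j) x) (at x within {0..})"
    and cont: "continuous_on {0..} (D (d - 1))"
    using Ck unfolding Ck_on_def by blast
  have Dcont: "continuous_on {0..} (D j)" if "j \<le> d - 1" for j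
  proof (cases "j = d - 1")
    case True
    then show ?thesis using cont by simp
  next
    case False
    then show ?thesis
      using der[of j] that by (intro DERIV_continuous_on[of "{0..}" "D j" "D (Suc j)"]) simp
  qed
  have "poly ((pderiv ^^ j) (p - [:c:])) a = 0" if "j < d" for j
  proof -
    have j: "j \<le> d - 1" using that by simp
    have agree: "D j a = poly ((pderiv ^^ j) q) a"
      if "open U" "U \<subseteq> {0..}" "closure U \<subseteq> {0..}" "a \<in> closure U"
        "\<And>x. x \<in> U \<Longrightarrow> \<phi> x = poly q x" for U q
    proof -
      have "D j x - poly ((pderiv ^^ j) q) x = 0" if "x \<in> U" for x
        using Ck_derivatives_eq_on_open[of "d - 1" "{0..}" D, OF der \<open>open U\<close> \<open>U \<subseteq> {0..}\<close> _ j that]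
          \<open>\<And>x. x \<in> U \<Longrightarrow> \<phi> x = poly q x\<close> D0 by simp
      moreover have "continuous_on (closure U) (\<lambda>x. D j x - poly ((pderiv ^^ j) q) x)"
        using continuous_on_subset[OF Dcont[OF j] that(3)] by (intro continuous_intros)
      ultimately show ?thesis
        using continuous_constant_on_closure[of U "\<lambda>x. D j x - poly ((pderiv ^^ j) q) x" 0 a] that(4)
        by simp
    qed
    have "D j a = poly ((pderiv ^^ j) p) a"
      by (rule agree[of "{0<..<a}"]) (use left \<open>0 < a\<close> in auto)
    moreover have "D j a = poly ((pderiv ^^ j) [:c:]) a"
      by (rule agree[of "{a<..}"]) (use right \<open>0 < a\<close> in auto)
    ultimately show ?thesis
      by (simp add: higher_pderiv_diff)
  qed
  moreover have "degree (p - [:c:]) \<le> d"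
    using assms(1) by (simp add: degree_diff_le)
  ultimately obtain \<alpha> where \<alpha>: "p - [:c:] = smult \<alpha> ([:-a, 1:] ^ d)"
    using poly_all_derivatives_vanish_imp_power by blast
  have "\<phi> r = c + \<alpha> * (r - a) ^ d" if "r \<in> {0..a}" for r
    using left[OF that] arg_cong[OF \<alpha>, of "\<lambda>p. poly p r"] by (simp add: poly_power)
  then show ?thesis by (intro exI[of _ \<alpha>] ballI)
qed

section \<open>Smoothness of truncated powers\<close>

lemma positive_part_power_has_derivative:
  fixes t :: real
  shows "((\<lambda>t. max 0 t ^ Suc (Suc m)) has_real_derivative real (Suc (Suc m)) * max 0 t ^ Suc m) (at t)"
proof -
  consider "t < 0" | "t > 0" | "t = 0" by linarith
  then show ?thesis
  proof cases
    case 1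
    have "((\<lambda>t. max 0 t ^ Suc (Suc m)) has_real_derivative 0) (at t)"
      by (rule has_field_derivative_transform_within_open[OF DERIV_const[of 0], where S = "{..<0}"])
         (use 1 in \<open>auto simp: max_def\<close>)
    then show ?thesis
      using 1 by (simp add: max_def)
  next
    case 2
    have "((\<lambda>t. max 0 t ^ Suc (Suc m)) has_real_derivative real (Suc (Suc m)) * t ^ Suc m) (at t)"
      by (rule has_field_derivative_transform_within_open[where f = "\<lambda>t. t ^ Suc (Suc m)" and S = "{0<..}"])
         (use 2 DERIV_pow[of "Suc (Suc m)" t UNIV] in \<open>auto simp: max_def\<close>)
    then show ?thesis
      using 2 by (simp add: max_def)
  next
    case 3
    have eq: "(max 0 (0 + h) ^ Suc (Suc m) - max 0 0 ^ Suc (Suc m)) / h = max 0 h ^ Suc m" for h :: real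
      by (simp add: max_def)
    have "((\<lambda>h::real. max 0 h ^ Suc m) \<longlongrightarrow> max 0 0 ^ Suc m) (at 0)"
      by (intro tendsto_intros)
    then show ?thesis
      unfolding 3 DERIV_def eq by simp
  qed
qed

lemma truncated_power_has_derivative:
  fixes \<rho> x :: real
  assumes "2 \<le> n"
  shows "((\<lambda>r. max 0 (1 - r / \<rho>) ^ n) has_real_derivative
           real n * max 0 (1 - x / \<rho>) ^ (n - 1) * (- 1 / \<rho>)) (at x)"
proof -
  obtain m where n: "n = Suc (Suc m)"
    using assms by (metis add_2_eq_Suc le_Suc_ex)
  have "((\<lambda>r. 1 - r / \<rho>) has_real_derivative - 1 / \<rho>) (at x)"
    using DERIV_diff[OF DERIV_const[of 1] DERIV_cdivide[OF DERIV_ident, of \<rho>]] by simp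
  from DERIV_chain2[OF positive_part_power_has_derivative this] show ?thesis
    unfolding n diff_Suc_1 .
qed

lemma truncated_power_Ck:
  fixes \<rho> v :: real
  assumes "0 < \<rho>" "0 < d" and \<phi>: "\<And>r. 0 \<le> r \<Longrightarrow> \<phi> r = v - v * max 0 (1 - r / \<rho>) ^ d"
  shows "Ck_on (d - 1) \<phi> {0..}"
proof -
  \<comment> \<open>the successive derivatives of the right-hand side; \<open>D\<close> replaces \<open>E 0\<close> by \<open>\<phi>\<close> itself, which
    may differ from it at negative arguments\<close>
  define E where "E j r = (if j = 0 then v else 0)
      - v * (\<Prod>i<j. - real (d - i) / \<rho>) * max 0 (1 - r / \<rho>) ^ (d - j)" for j r
  define D where "D j = (if j = 0 then \<phi> else E j)" for j
  have DE: "D j r = E j r" if "0 \<le> r" for j r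
    using \<phi>[OF that] by (simp add: D_def E_def)
  have "(E j has_real_derivative E (Suc j) x) (at x)" if "j < d - 1" for j x
  proof -
    let ?K = "v * (\<Prod>i<j. - real (d - i) / \<rho>)"
    have "2 \<le> d - j" using that by auto
    then have "(E j has_real_derivative
        0 - ?K * (real (d - j) * max 0 (1 - x / \<rho>) ^ (d - j - 1) * (- 1 / \<rho>))) (at x)"
      unfolding E_def
      by (intro DERIV_diff DERIV_const DERIV_cmult truncated_power_has_derivative)
    then show ?thesis
      by (simp add: E_def mult.assoc)
  qed
  then have "(D j has_real_derivative D (Suc j) x) (at x within {0..})"
    if "j < d - 1" "0 \<le> x" for j x
    using has_field_derivative_transform_within
            [OF has_field_derivative_at_within[of "E j" "E (Suc j) x" x "{0..}"], of 1 "D j"]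
      that DE by simp
  moreover have "continuous_on {0..} (E (d - 1))"
    unfolding E_def using assms(1) by (intro continuous_intros) simp_all
  then have "continuous_on {0..} (D (d - 1))"
    by (rule continuous_on_eq) (simp add: DE)
  ultimately show ?thesis
    unfolding Ck_on_def by (intro exI[of _ D]) (auto simp: D_def)
qed


section \<open>Presenting a polytope by unit normals of its facets\<close>

text \<open>The last assumption is the form in which irredundancy of the half-spaces is used: each
  facet contains a point that lies strictly inside all other half-spaces.\<close>

locale unit_normal_presentation =
  fixes P :: "'a::euclidean_space set" and I :: "'i set" and u :: "'i \<Rightarrow> 'a" and \<beta> :: "'i \<Rightarrow> real"
  assumes compact_P: "compact P" and interior_P: "interior P \<noteq> {}"
    and finite_I: "finite I"
    and norm_u: "i \<in> I \<Longrightarrow> norm (u i) = 1"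
    and P_eq: "P = {x. \<forall>i\<in>I. u i \<bullet> x \<le> \<beta> i}"
    and facet_iff: "F facet_of P \<longleftrightarrow> (\<exists>i\<in>I. F = P \<inter> {x. u i \<bullet> x = \<beta> i})"
    and facet_point: "i \<in> I \<Longrightarrow> \<exists>z. u i \<bullet> z = \<beta> i \<and> (\<forall>k\<in>I - {i}. u k \<bullet> z < \<beta> k)"

lemma full_polytope_unit_normal_presentation:
  fixes P :: "'a::euclidean_space set"
  assumes "full_polytope P"
  shows "\<exists>(Hs :: 'a set set) u \<beta>. unit_normal_presentation P Hs u \<beta>"
proof -
  have P: "compact P" "interior P \<noteq> {}" "polyhedron P"
    using assms by (auto simp: full_polytope_def)
  have aff: "affine hull P = UNIV"
    using P(2) by (rule affine_hull_nonempty_interior)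
  obtain Hs where Hs: "finite Hs" "P = \<Inter>Hs"
      "\<forall>h\<in>Hs. \<exists>a b. a \<noteq> 0 \<and> h = {x. a \<bullet> x \<le> b}"
      "\<And>Hs'. Hs' \<subset> Hs \<Longrightarrow> P \<subset> \<Inter>Hs'"
    using P(3) unfolding polyhedron_Int_affine_minimal by (auto simp: aff)
  then obtain a b where ab: "\<And>h. h \<in> Hs \<Longrightarrow> a h \<noteq> 0 \<and> h = {x. a h \<bullet> x \<le> b h}"
    by metis
  define u where "u h = a h /\<^sub>R norm (a h)" for h
  define \<beta> where "\<beta> h = b h / norm (a h)" for h
  have u: "norm (u h) = 1" "u h \<noteq> 0 \<and> h = {x. u h \<bullet> x \<le> \<beta> h}" if "h \<in> Hs" for h
  proof -
    have "a h \<noteq> 0" and h: "h = {x. a h \<bullet> x \<le> b h}" using ab[OF that] by auto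
    then show "norm (u h) = 1" by (simp add: u_def)
    have "{x. u h \<bullet> x \<le> \<beta> h} = {x. a h \<bullet> x \<le> b h}"
      using \<open>a h \<noteq> 0\<close> by (simp add: u_def \<beta>_def field_simps)
    then show "u h \<noteq> 0 \<and> h = {x. u h \<bullet> x \<le> \<beta> h}"
      using \<open>a h \<noteq> 0\<close> h by (auto simp: u_def)
  qed
  have PHs: "P = affine hull P \<inter> \<Inter>Hs" and min: "\<And>Hs'. Hs' \<subset> Hs \<Longrightarrow> P \<subset> affine hull P \<inter> \<Inter>Hs'"
    using Hs aff by auto
  have P_eq: "P = {x. \<forall>h\<in>Hs. u h \<bullet> x \<le> \<beta> h}"
    using Hs(2) u(2) by fastforce
  have facets: "F facet_of P \<longleftrightarrow> (\<exists>h\<in>Hs. F = P \<inter> {x. u h \<bullet> x = \<beta> h})" for F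
    using facet_of_polyhedron_explicit[OF Hs(1) PHs u(2) min] by blast
  \<comment> \<open>To find a facet point for \<open>h\<close>, join an interior point \<open>x0\<close> to a point \<open>y\<close> that violates only the
    inequality of \<open>h\<close>; the segment leaves \<open>P\<close> through the facet of \<open>h\<close> alone.\<close>
  obtain x0 where "x0 \<in> interior P" using P(2) by blast
  then have "x0 \<in> rel_interior P"
    using interior_subset_rel_interior by blast
  then have x0: "\<And>h. h \<in> Hs \<Longrightarrow> u h \<bullet> x0 < \<beta> h"
    using rel_interior_polyhedron_explicit[OF Hs(1) PHs u(2) min] by simp
  have "\<exists>z. u h \<bullet> z = \<beta> h \<and> (\<forall>k\<in>Hs - {h}. u k \<bullet> z < \<beta> k)" if h: "h \<in> Hs" for h
  proof -
    have "P \<subset> \<Inter>(Hs - {h})"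
      using Hs(4) h by blast
    then obtain y where y: "y \<in> \<Inter>(Hs - {h})" "y \<notin> P" by blast
    then have yk: "u k \<bullet> y \<le> \<beta> k" if "k \<in> Hs - {h}" for k
      using u(2)[of k] that by blast
    obtain k where k: "k \<in> Hs" "\<beta> k < u k \<bullet> y"
      using y(2) P_eq by (auto simp: not_le)
    with yk[of k] have "k = h" by (cases "k = h") auto
    with k have yh: "\<beta> h < u h \<bullet> y" by simp
    define t where "t = (\<beta> h - u h \<bullet> x0) / (u h \<bullet> y - u h \<bullet> x0)"
    have t: "0 < t" "t < 1"
      using x0[OF h] yh by (auto simp: t_def field_simps)
    define z where "z = (1 - t) *\<^sub>R x0 + t *\<^sub>R y"
    have zk: "u k \<bullet> z = (1 - t) * (u k \<bullet> x0) + t * (u k \<bullet> y)" for k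
      by (simp add: z_def inner_add_right)
    have "t * (u h \<bullet> y - u h \<bullet> x0) = \<beta> h - u h \<bullet> x0"
      using x0[OF h] yh by (simp add: t_def)
    then have "u h \<bullet> z = \<beta> h"
      by (simp add: zk algebra_simps)
    moreover have "u k \<bullet> z < \<beta> k" if k: "k \<in> Hs - {h}" for k
    proof -
      have "(1 - t) * (u k \<bullet> x0) < (1 - t) * \<beta> k"
        using x0[of k] k t by simp
      moreover have "t * (u k \<bullet> y) \<le> t * \<beta> k"
        using yk[OF k] t by simp
      ultimately show ?thesis
        unfolding zk by (simp add: algebra_simps)
    qed
    ultimately show ?thesis by blast
  qed
  then have "unit_normal_presentation P Hs u \<beta>"
    by unfold_locales (use P u Hs(1) P_eq facets in auto)
  then show ?thesis by blast
qed

section \<open>Inner parallel bodies\<close>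

lemma cball_subset_halfspace_iff:
  fixes u :: "'a::euclidean_space"
  assumes "norm u = 1" "0 \<le> r"
  shows "cball x r \<subseteq> {y. u \<bullet> y \<le> b} \<longleftrightarrow> u \<bullet> x \<le> b - r"
proof
  assume *: "cball x r \<subseteq> {y. u \<bullet> y \<le> b}"
  have "x + r *\<^sub>R u \<in> cball x r"
    using assms by (simp add: dist_norm)
  then have "u \<bullet> (x + r *\<^sub>R u) \<le> b" using * by blast
  then show "u \<bullet> x \<le> b - r"
    using assms by (simp add: inner_add_right dot_square_norm)
next
  assume *: "u \<bullet> x \<le> b - r"
  show "cball x r \<subseteq> {y. u \<bullet> y \<le> b}"
  proof
    fix y assume "y \<in> cball x r"
    then have "norm (y - x) \<le> r" by (simp add: dist_norm norm_minus_commute)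
    then have "u \<bullet> (y - x) \<le> r"
      using norm_cauchy_schwarz[of u "y - x"] assms by simp
    then show "y \<in> {y. u \<bullet> y \<le> b}"
      using * by (simp add: inner_diff_right)
  qed
qed

text \<open>A ball around a point of \<open>P\<close> is connected, so it cannot leave \<open>P\<close> without meeting the
  frontier.\<close>

lemma infdist_frontier_ge_iff:
  fixes P :: "'a::euclidean_space set"
  assumes "compact P" "x \<in> P" "0 \<le> r"
  shows "r \<le> infdist x (frontier P) \<longleftrightarrow> cball x r \<subseteq> P"
proof
  assume *: "r \<le> infdist x (frontier P)"
  have "ball x r \<inter> frontier P = {}"
    using * infdist_le[of _ "frontier P" x] by fastforce
  then have "ball x r \<subseteq> P" if "r > 0"
    using connected_Int_frontier[of "ball x r" P] that \<open>x \<in> P\<close> centre_in_ball[of x r]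
      connected_ball by blast
  then show "cball x r \<subseteq> P"
  proof (cases "r = 0")
    case False
    then have "closure (ball x r) \<subseteq> P"
      using \<open>r > 0 \<Longrightarrow> ball x r \<subseteq> P\<close> assms by (intro closure_minimal) (auto intro: compact_imp_closed)
    then show ?thesis
      using False assms by simp
  qed (use assms in auto)
next
  assume *: "cball x r \<subseteq> P"
  have "P \<noteq> UNIV" using assms(1) compact_imp_bounded not_bounded_UNIV by blast
  then have ne: "frontier P \<noteq> {}"
    using assms(2) frontier_not_empty by blast
  have "ball x r \<subseteq> interior P"
    using * by (intro interior_maximal) auto
  then have "r \<le> dist x a" if "a \<in> frontier P" for a
    using that by (auto simp: frontier_def subset_iff not_less[symmetric])
  then show "r \<le> infdist x (frontier P)"
    using ne by (simp add: infdist_notempty cINF_greatest)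
qed

lemma measure_homothety:
  fixes c :: "'a::euclidean_space"
  assumes "0 \<le> s"
  shows "measure lebesgue ((\<lambda>x. c + s *\<^sub>R (x - c)) ` S) = s ^ DIM('a) * measure lebesgue S"
proof -
  have "(\<lambda>x. c + s *\<^sub>R (x - c)) ` S = (\<lambda>x. s *\<^sub>R x + (1 - s) *\<^sub>R c) ` S"
    by (intro image_cong) (auto simp: algebra_simps)
  then show ?thesis
    using measure_lebesgue_affine[of s "(1 - s) *\<^sub>R c" S] assms by simp
qed

text \<open>The interior of \<open>B\<close> outside \<open>A\<close> is open and of measure zero, hence empty, and a convex body is the
  closure of its interior.\<close>

lemma closed_subset_convex_same_measure_eq:
  fixes A B :: "'a::euclidean_space set"
  assumes "A \<subseteq> B" "closed A" "convex B" "compact B" "interior B \<noteq> {}"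
    and "measure lebesgue A = measure lebesgue B"
  shows "A = B"
proof -
  have "compact A"
    using assms by (metis closed_Int_compact inf.absorb1)
  then have "measure lebesgue (B - A) = 0"
    using measurable_measure_Diff[OF lmeasurable_compact[OF \<open>compact B\<close>], of A] assms
      lmeasurable_compact[of A] by (simp add: fmeasurableD)
  then have "negligible (B - A)"
    using assms \<open>compact A\<close> by (simp add: negligible_iff_measure0 fmeasurable.Diff fmeasurableD lmeasurable_compact)
  then have "negligible (interior B - A)"
    by (rule negligible_subset) (use interior_subset in blast)
  moreover have "open (interior B - A)" using assms by (simp add: open_Diff)
  ultimately have "interior B \<subseteq> A"
    using open_not_negligible by blast
  then have "closure (interior B) \<subseteq> A"
    using assms(2) by (simp add: closure_minimal)
  moreover have "closure (interior B) = B"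
    using convex_closure_interior assms compact_imp_closed closure_closed by metis
  ultimately show ?thesis using assms(1) by blast
qed

context unit_normal_presentation
begin

lemma I_nonempty: "I \<noteq> {}"
  using P_eq compact_P compact_imp_bounded not_bounded_UNIV by fastforce

lemma cball_subset_iff:
  assumes "0 \<le> r"
  shows "cball x r \<subseteq> P \<longleftrightarrow> x \<in> r_interior P r"
  using infdist_frontier_ge_iff[OF compact_P _ assms] assms centre_in_cball[of x r]
  unfolding r_interior_def by blast

text \<open>A ball lies in \<open>P\<close> exactly when it lies in every half-space, so the \<open>r\<close>-interior arises by
  pushing each bounding hyperplane inwards by \<open>r\<close>.\<close>

lemma r_interior_eq:
  assumes "0 \<le> r"
  shows "r_interior P r = {x. \<forall>i\<in>I. u i \<bullet> x \<le> \<beta> i - r}"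
proof -
  have "cball x r \<subseteq> P \<longleftrightarrow> (\<forall>i\<in>I. cball x r \<subseteq> {y. u i \<bullet> y \<le> \<beta> i})" for x
    unfolding P_eq by blast
  then show ?thesis
    using assms norm_u by (auto simp: cball_subset_halfspace_iff simp flip: cball_subset_iff)
qed

lemma compact_r_interior: "compact (r_interior P r)"
proof -
  have "r_interior P r = P \<inter> {x. r \<le> infdist x (frontier P)}"
    by (auto simp: r_interior_def)
  moreover have "closed {x. r \<le> infdist x (frontier P)}"
    by (intro closed_Collect_le continuous_intros)
  ultimately show ?thesis using compact_P by (simp add: compact_Int_closed)
qed

lemma convex_r_interior:
  assumes "0 \<le> r"
  shows "convex (r_interior P r)"
proof -
  have "r_interior P r = (\<Inter>i\<in>I. {x. u i \<bullet> x \<le> \<beta> i - r})"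
    unfolding r_interior_eq[OF assms] by blast
  then show ?thesis by (simp add: convex_INT convex_halfspace_le)
qed

lemma inner_nbhd_volume_eq:
  "inner_nbhd_volume P r = measure lebesgue P - measure lebesgue (r_interior P r)"
  unfolding inner_nbhd_volume_def
  using compact_P compact_r_interior[of r]
  by (intro measurable_measure_Diff)
     (auto simp: lmeasurable_compact fmeasurableD r_interior_def)

lemma measure_P_pos: "0 < measure lebesgue P"
proof -
  have "\<not> negligible P"
    using interior_P open_not_negligible[OF open_interior] negligible_subset[OF _ interior_subset]
    by blast
  then show ?thesis
    using compact_P by (simp add: negligible_iff_measure0 lmeasurable_compact zero_less_measure_iff)
qed

section \<open>Inscribed balls and their heights over the facets\<close>

text \<open>A ball in \<open>P\<close> forces all heights to be at least \<open>\<rho>\<close>, and a point of the sphere on the \<open>i\<close>-th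
  facet hyperplane forces the height over it to be at most \<open>\<rho>\<close>. When the height equals \<open>\<rho>\<close>, the equality
  case of Cauchy-Schwarz leaves \<open>c + \<rho> u\<^sub>i\<close> as the only point of contact.\<close>

lemma inscribed_ball_iff:
  assumes "0 < \<rho>"
  shows "inscribed_ball P c \<rho> \<longleftrightarrow> (\<forall>i\<in>I. \<beta> i - u i \<bullet> c = \<rho>)"
proof
  assume *: "inscribed_ball P c \<rho>"
  show "\<forall>i\<in>I. \<beta> i - u i \<bullet> c = \<rho>"
  proof
    fix i assume i: "i \<in> I"
    have "u i \<bullet> c \<le> \<beta> i - \<rho>"
      using * assms i cball_subset_iff[of \<rho> c] by (simp add: inscribed_ball_def r_interior_eq)
    moreover obtain x where "x \<in> P \<inter> {x. u i \<bullet> x = \<beta> i}" "x \<in> sphere c \<rho>"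
      using * i facet_iff unfolding inscribed_ball_def tangent_to_facet_def by blast
    then have "u i \<bullet> (x - c) \<le> \<rho>" "u i \<bullet> x = \<beta> i"
      using norm_cauchy_schwarz[of "u i" "x - c"] norm_u[OF i]
      by (auto simp: dist_norm norm_minus_commute)
    ultimately show "\<beta> i - u i \<bullet> c = \<rho>"
      by (simp add: inner_diff_right)
  qed
next
  assume h: "\<forall>i\<in>I. \<beta> i - u i \<bullet> c = \<rho>"
  have "c \<in> r_interior P \<rho>"
    using h assms by (auto simp: r_interior_eq)
  then have sub: "cball c \<rho> \<subseteq> P"
    using assms by (simp add: cball_subset_iff)
  have "tangent_to_facet c \<rho> F" if "F facet_of P" for F
  proof -
    obtain i where i: "i \<in> I" "F = P \<inter> {x. u i \<bullet> x = \<beta> i}"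
      using \<open>F facet_of P\<close> facet_iff[of F] by (elim iffE impE bexE) auto
    have uu: "u i \<bullet> u i = 1" using norm_u[OF i(1)] by (simp add: dot_square_norm)
    let ?x = "c + \<rho> *\<^sub>R u i"
    have xs: "?x \<in> sphere c \<rho>"
      using assms norm_u[OF i(1)] by (simp add: dist_norm)
    moreover have "u i \<bullet> ?x = \<beta> i"
      using h i(1) uu by (simp add: inner_add_right algebra_simps)
    ultimately have xF: "?x \<in> F"
      using sub sphere_cball[of c \<rho>] i(2) by blast
    have aff: "affine hull F \<subseteq> {x. u i \<bullet> x = \<beta> i}"
      by (rule hull_minimal) (use i affine_hyperplane in auto)
    have "y = ?x" if "y \<in> sphere c \<rho>" "y \<in> affine hull F" for y
    proof -
      have "norm (y - c) = \<rho>"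
        using that(1) by (simp add: dist_norm norm_minus_commute)
      moreover have "u i \<bullet> (y - c) = \<rho>"
        using that(2) aff h i(1) by (auto simp: inner_diff_right)
      ultimately have "y - c = \<rho> *\<^sub>R u i"
        using norm_cauchy_schwarz_eq[of "u i" "y - c"] norm_u[OF i(1)] by simp
      then show ?thesis by (simp add: algebra_simps)
    qed
    then have "sphere c \<rho> \<inter> affine hull F = {?x}"
      using xs xF hull_inc[of ?x F affine] by blast
    then show ?thesis
      using xF unfolding tangent_to_facet_def by blast
  qed
  then show "inscribed_ball P c \<rho>"
    using assms sub by (simp add: inscribed_ball_def)
qed

text \<open>Shrinking by \<open>1 - t\<close> moves the facet of height \<open>h \<ge> g\<close> inwards by \<open>t h \<ge> t g\<close>.\<close>

lemma homothetic_copy_subset_r_interior: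
  assumes ball: "cball c g \<subseteq> P" and "0 < g" "0 \<le> t" "t \<le> 1"
  shows "(\<lambda>x. c + (1 - t) *\<^sub>R (x - c)) ` P \<subseteq> r_interior P (t * g)"
proof -
  have "u i \<bullet> (c + (1 - t) *\<^sub>R (x - c)) \<le> \<beta> i - t * g" if "x \<in> P" "i \<in> I" for x i
  proof -
    have "u i \<bullet> c \<le> \<beta> i - g"
      using ball that(2) assms(2) by (simp add: cball_subset_iff r_interior_eq)
    then have "t * (u i \<bullet> c) \<le> t * (\<beta> i - g)"
      using assms(3) by (rule mult_left_mono)
    moreover have "(1 - t) * (u i \<bullet> x) \<le> (1 - t) * \<beta> i"
      using that assms(4) P_eq by (intro mult_left_mono) auto
    ultimately show ?thesis
      by (simp add: inner_add_right inner_diff_right algebra_simps)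
  qed
  then show ?thesis
    using assms by (auto simp: r_interior_eq)
qed

lemma r_interior_inscribed:
  assumes h: "\<And>i. i \<in> I \<Longrightarrow> \<beta> i - u i \<bullet> c = \<rho>" and "0 < \<rho>" "0 \<le> r" "r < \<rho>"
  shows "r_interior P r = (\<lambda>x. c + (1 - r / \<rho>) *\<^sub>R (x - c)) ` P"
proof
  have "cball c \<rho> \<subseteq> P"
    using h assms(2) by (simp add: cball_subset_iff r_interior_eq) (smt (verit))
  then show "(\<lambda>x. c + (1 - r / \<rho>) *\<^sub>R (x - c)) ` P \<subseteq> r_interior P r"
    using homothetic_copy_subset_r_interior[of c \<rho> "r / \<rho>"] assms by simp
  show "r_interior P r \<subseteq> (\<lambda>x. c + (1 - r / \<rho>) *\<^sub>R (x - c)) ` P"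
  proof
    fix y assume y: "y \<in> r_interior P r"
    define s where "s = 1 - r / \<rho>"
    have s: "0 < s" "s * \<rho> = \<rho> - r" using assms by (auto simp: s_def field_simps)
    define x where "x = c + (1 / s) *\<^sub>R (y - c)"
    have "u i \<bullet> x \<le> \<beta> i" if i: "i \<in> I" for i
    proof -
      have "u i \<bullet> (y - c) \<le> s * \<rho>"
        using y i h[OF i] s(2) assms(3) by (auto simp: r_interior_eq inner_diff_right)
      then have "u i \<bullet> (y - c) / s \<le> \<rho>"
        using s by (simp add: field_simps)
      then show ?thesis
        using h[OF i] by (simp add: x_def inner_add_right)
    qed
    then have "x \<in> P" unfolding P_eq by blast
    moreover have "y = c + s *\<^sub>R (x - c)"
      using s by (simp add: x_def)
    ultimately show "y \<in> (\<lambda>x. c + (1 - r / \<rho>) *\<^sub>R (x - c)) ` P"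
      unfolding s_def by blast
  qed
qed

text \<open>Moving a point \<open>z\<close> of the \<open>i\<close>-th facet inwards by \<open>t g\<close> along the normal gives, for small \<open>t\<close>, a point
  of \<open>P(t g)\<close>. It belongs to the homothetic copy only if the copy's \<open>i\<close>-th facet, at depth \<open>t\<close> times the
  height, has not passed beyond it.\<close>

lemma homothetic_r_interior_imp_equal_heights:
  assumes ball: "cball c g \<subseteq> P" and "0 < g"
    and hom: "\<And>t. 0 < t \<Longrightarrow> t < 1 \<Longrightarrow> r_interior P (t * g) \<subseteq> (\<lambda>x. c + (1 - t) *\<^sub>R (x - c)) ` P"
    and i: "i \<in> I"
  shows "\<beta> i - u i \<bullet> c = g"
proof -
  obtain z where z: "u i \<bullet> z = \<beta> i" "\<And>k. k \<in> I - {i} \<Longrightarrow> u k \<bullet> z < \<beta> k"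
    using facet_point[OF i] by blast
  have uu: "u k \<bullet> u k = 1" if "k \<in> I" for k
    using norm_u[OF that] by (simp add: dot_square_norm)
  \<comment> \<open>The factor 2: moving \<open>z\<close> changes \<open>u\<^sub>k \<bullet> z\<close> by at most \<open>t g\<close>, and the bound \<open>\<beta>\<^sub>k\<close> drops by \<open>t g\<close> too.\<close>
  have "\<exists>t>0. t < 1 \<and> (\<forall>k\<in>I - {i}. u k \<bullet> z + 2 * (t * g) < \<beta> k)"
  proof -
    have "\<forall>k\<in>I - {i}. \<forall>\<^sub>F t in at_right 0. u k \<bullet> z + 2 * (t * g) < \<beta> k"
    proof
      fix k assume k: "k \<in> I - {i}"
      have "((\<lambda>t. u k \<bullet> z + 2 * (t * g)) \<longlongrightarrow> u k \<bullet> z + 2 * (0 * g)) (at_right 0)"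
        by (intro tendsto_intros)
      then show "\<forall>\<^sub>F t in at_right 0. u k \<bullet> z + 2 * (t * g) < \<beta> k"
        by (rule order_tendstoD(2)) (use z(2)[OF k] in simp)
    qed
    then have "\<forall>\<^sub>F t in at_right 0. \<forall>k\<in>I - {i}. u k \<bullet> z + 2 * (t * g) < \<beta> k"
      using finite_I by (simp add: eventually_ball_finite)
    moreover have "\<forall>\<^sub>F t::real in at_right 0. t \<in> {0<..<1}"
      by (rule eventually_at_right_real) simp
    ultimately have "\<forall>\<^sub>F t in at_right 0. t \<in> {0<..<1} \<and> (\<forall>k\<in>I - {i}. u k \<bullet> z + 2 * (t * g) < \<beta> k)"
      by eventually_elim auto
    then show ?thesis
      using eventually_happens'[of "at_right (0::real)"] by (auto dest!: eventually_happens)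
  qed
  then obtain t where t: "0 < t" "t < 1" "\<And>k. k \<in> I - {i} \<Longrightarrow> u k \<bullet> z + 2 * (t * g) < \<beta> k"
    by blast
  define y where "y = z - (t * g) *\<^sub>R u i"
  have "u k \<bullet> y \<le> \<beta> k - t * g" if k: "k \<in> I" for k
  proof (cases "k = i")
    case True
    then show ?thesis using z(1) uu[OF i] by (simp add: y_def inner_diff_right)
  next
    case False
    have "- (u k \<bullet> u i) \<le> 1"
      using norm_cauchy_schwarz[of "u k" "- u i"] norm_u k i by simp
    then have "(t * g) * (- (u k \<bullet> u i)) \<le> t * g * 1"
      using t(1) \<open>0 < g\<close> by (intro mult_left_mono) auto
    then show ?thesis
      using t(3)[of k] False k by (simp add: y_def inner_diff_right)
  qed
  then have "y \<in> r_interior P (t * g)"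
    using t(1) \<open>0 < g\<close> by (simp add: r_interior_eq)
  then obtain x where x: "x \<in> P" "y = c + (1 - t) *\<^sub>R (x - c)"
    using hom t by blast
  have "u i \<bullet> y = \<beta> i - t * g"
    using z(1) uu[OF i] by (simp add: y_def inner_diff_right)
  moreover have "u i \<bullet> y \<le> u i \<bullet> c + (1 - t) * (\<beta> i - u i \<bullet> c)"
    using x t i P_eq by (auto simp: inner_add_right inner_diff_right intro!: mult_left_mono)
  ultimately have "t * (\<beta> i - u i \<bullet> c) \<le> t * g"
    by (simp add: algebra_simps)
  then have "\<beta> i - u i \<bullet> c \<le> g"
    using t(1) by simp
  moreover have "u i \<bullet> c \<le> \<beta> i - g"
    using ball i \<open>0 < g\<close> by (simp add: cball_subset_iff r_interior_eq)
  ultimately show ?thesis by simp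
qed

text \<open>If \<open>x\<close> were another point of \<open>P(r)\<close>, then \<open>u\<^sub>i \<bullet> (x - c) \<le> \<rho> - r \<le> 0\<close> for all \<open>i\<close>, and \<open>P\<close> would
  contain the whole ray from \<open>c\<close> through \<open>x\<close>, although it is bounded.\<close>

lemma r_interior_subset_center:
  assumes h: "\<And>i. i \<in> I \<Longrightarrow> \<beta> i - u i \<bullet> c = \<rho>" and "0 < \<rho>" "\<rho> \<le> r"
  shows "r_interior P r \<subseteq> {c}"
proof
  fix x assume x: "x \<in> r_interior P r"
  have le: "u i \<bullet> (x - c) \<le> 0" if "i \<in> I" for i
    using x h[OF that] that assms(2,3) by (auto simp: r_interior_eq inner_diff_right)
  have ray: "c + s *\<^sub>R (x - c) \<in> P" if "0 \<le> s" for s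
  proof -
    have "u i \<bullet> (c + s *\<^sub>R (x - c)) \<le> \<beta> i" if "i \<in> I" for i
      using mult_nonneg_nonpos[OF \<open>0 \<le> s\<close> le[OF that]] h[OF that] assms(2)
      by (simp add: inner_add_right)
    then show ?thesis unfolding P_eq by blast
  qed
  obtain B where B: "\<And>y. y \<in> P \<Longrightarrow> norm y \<le> B"
    using compact_P compact_imp_bounded bounded_iff by metis
  show "x \<in> {c}"
  proof (rule ccontr)
    assume "x \<notin> {c}"
    then have pos: "0 < norm (x - c)" by simp
    have "0 \<le> B" using B[OF ray[of 0]] norm_ge_zero order_trans by blast
    \<comment> \<open>far enough along the ray to have norm at least \<open>B + 1\<close>\<close>
    define s where "s = (B + norm c + 1) / norm (x - c)"
    have "0 \<le> s" using \<open>0 \<le> B\<close> by (simp add: s_def)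
    have "norm (s *\<^sub>R (x - c)) = B + norm c + 1"
      using pos \<open>0 \<le> B\<close> by (simp add: s_def)
    moreover have "norm (s *\<^sub>R (x - c)) \<le> norm (c + s *\<^sub>R (x - c)) + norm c"
      using norm_triangle_ineq4[of "c + s *\<^sub>R (x - c)" c] by simp
    ultimately show False
      using B[OF ray[OF \<open>0 \<le> s\<close>]] by simp
  qed
qed

lemma inradius_inscribed:
  assumes "inscribed_ball P c \<rho>"
  shows "inradius P = \<rho>"
  unfolding inradius_def
proof (rule Greatest_equality)
  have \<rho>: "0 < \<rho>" and ball: "cball c \<rho> \<subseteq> P"
    using assms by (auto simp: inscribed_ball_def)
  then show "\<rho> > 0 \<and> (\<exists>c. cball c \<rho> \<subseteq> P)" by blast
  have h: "\<beta> i - u i \<bullet> c = \<rho>" if "i \<in> I" for i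
    using assms inscribed_ball_iff[OF \<rho>] that by blast
  fix g assume g: "g > 0 \<and> (\<exists>c'. cball c' g \<subseteq> P)"
  then obtain c' where c': "c' \<in> r_interior P g"
    by (auto simp: cball_subset_iff)
  show "g \<le> \<rho>"
  proof (rule ccontr)
    assume "\<not> g \<le> \<rho>"
    then have "c \<in> r_interior P g"
      using r_interior_subset_center[OF h \<rho>, of g] c' by auto
    moreover obtain i where "i \<in> I" using I_nonempty by blast
    ultimately show False
      using h[of i] g \<open>\<not> g \<le> \<rho>\<close> by (auto simp: r_interior_eq)
  qed
qed

lemma volume_of_inscribed:
  assumes "inscribed_ball P c \<rho>" "0 \<le> r"
  shows "inner_nbhd_volume P r =
    measure lebesgue P - measure lebesgue P * max 0 (1 - r / \<rho>) ^ DIM('a)"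
proof -
  have \<rho>: "0 < \<rho>" using assms by (simp add: inscribed_ball_def)
  have h: "\<beta> i - u i \<bullet> c = \<rho>" if "i \<in> I" for i
    using assms inscribed_ball_iff[OF \<rho>] that by blast
  show ?thesis
  proof (cases "r < \<rho>")
    case True
    then have s: "0 \<le> 1 - r / \<rho>" using \<rho> by simp
    have "measure lebesgue (r_interior P r) = (1 - r / \<rho>) ^ DIM('a) * measure lebesgue P"
      using r_interior_inscribed[OF h \<rho> assms(2) True] measure_homothety[OF s, of c P] by simp
    then show ?thesis
      using s by (simp add: inner_nbhd_volume_eq mult.commute)
  next
    case False
    then have "r_interior P r \<subseteq> {c}" using r_interior_subset_center[OF h \<rho>] by simp
    then have "measure lebesgue (r_interior P r) = 0"
      by (meson negligible_imp_measure0 negligible_sing negligible_subset)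
    moreover have "max 0 (1 - r / \<rho>) = 0" using False \<rho> by simp
    ultimately show ?thesis
      by (simp add: inner_nbhd_volume_eq)
  qed
qed

section \<open>From the volume function to an inscribed ball\<close>

lemma inscribed_ball_of_power_volume:
  assumes "0 < g"
    and vol: "\<And>r. 0 \<le> r \<Longrightarrow> r \<le> g \<Longrightarrow>
      inner_nbhd_volume P r = measure lebesgue P - measure lebesgue P * (1 - r / g) ^ DIM('a)"
  shows "\<exists>c. inscribed_ball P c g"
proof -
  have meas: "measure lebesgue (r_interior P r) = (1 - r / g) ^ DIM('a) * measure lebesgue P"
    if "0 \<le> r" "r \<le> g" for r
    using vol[OF that] by (simp add: inner_nbhd_volume_eq mult.commute)
  have meas_pos: "0 < measure lebesgue (r_interior P r)" if "0 \<le> r" "r < g" for r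
    using that meas[of r] measure_P_pos assms(1) by simp
  have "P \<noteq> {}" using interior_P interior_subset by blast
  \<comment> \<open>An incentre: every \<open>P(r)\<close> with \<open>r < g\<close> has positive volume, so this maximum is at least \<open>g\<close>.\<close>
  then obtain c where c: "c \<in> P" "\<And>x. x \<in> P \<Longrightarrow> infdist x (frontier P) \<le> infdist c (frontier P)"
    using continuous_attains_sup[OF compact_P _ continuous_on_infdist[OF continuous_on_id]] by metis
  have "r \<le> infdist c (frontier P)" if "0 \<le> r" "r < g" for r
  proof -
    have "r_interior P r \<noteq> {}" using meas_pos[OF that] by auto
    then obtain x where "x \<in> P" "r \<le> infdist x (frontier P)"
      by (auto simp: r_interior_def)
    then show ?thesis using c(2) order_trans by blast
  qed
  then have "g \<le> infdist c (frontier P)"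
    using assms(1) dense_ge_bounded[of 0 g] dense_le_bounded[of 0 g] by simp
  then have ball: "cball c g \<subseteq> P"
    using assms(1) c(1) infdist_frontier_ge_iff[OF compact_P c(1)] by simp
  have "r_interior P (t * g) \<subseteq> (\<lambda>x. c + (1 - t) *\<^sub>R (x - c)) ` P" if t: "0 < t" "t < 1" for t
  proof -
    have tg: "0 \<le> t * g" "t * g < g" using t assms(1) by auto
    have "(\<lambda>x. c + (1 - t) *\<^sub>R (x - c)) ` P = r_interior P (t * g)"
    proof (rule closed_subset_convex_same_measure_eq)
      show "(\<lambda>x. c + (1 - t) *\<^sub>R (x - c)) ` P \<subseteq> r_interior P (t * g)"
        using homothetic_copy_subset_r_interior[OF ball assms(1)] t by simp
      show "closed ((\<lambda>x. c + (1 - t) *\<^sub>R (x - c)) ` P)"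
        by (intro compact_imp_closed compact_continuous_image continuous_intros compact_P)
      show "convex (r_interior P (t * g))"
        using convex_r_interior[OF tg(1)] .
      then show "interior (r_interior P (t * g)) \<noteq> {}"
        using meas_pos[OF tg] negligible_convex_interior[of "r_interior P (t * g)"]
          negligible_imp_measure0 by force
      show "compact (r_interior P (t * g))" by (rule compact_r_interior)
      show "measure lebesgue ((\<lambda>x. c + (1 - t) *\<^sub>R (x - c)) ` P)
          = measure lebesgue (r_interior P (t * g))"
        using meas[of "t * g"] t tg assms(1) by (simp add: measure_homothety)
    qed
    then show ?thesis by simp
  qed
  then have "\<forall>i\<in>I. \<beta> i - u i \<bullet> c = g"
    using homothetic_r_interior_imp_equal_heights[OF ball assms(1)] by blast
  then show ?thesis
    using inscribed_ball_iff[OF assms(1)] by blast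
qed


lemma r_interior_0: "r_interior P 0 = P"
  by (auto simp: r_interior_def infdist_nonneg)

lemma r_interior_eventually_empty: "\<exists>R. \<forall>r\<ge>R. r_interior P r = {}"
proof -
  obtain i where i: "i \<in> I" using I_nonempty by blast
  obtain B where B: "\<And>x. x \<in> P \<Longrightarrow> norm x \<le> B"
    using compact_P compact_imp_bounded bounded_iff by metis
  have "r_interior P r = {}" if r: "max 0 (\<beta> i + B + 1) \<le> r" for r
  proof (rule ccontr)
    assume "r_interior P r \<noteq> {}"
    then obtain x where x: "x \<in> r_interior P r" by blast
    then have "u i \<bullet> x \<le> \<beta> i - r" "norm x \<le> B"
      using r_interior_eq[of r] r i B by (auto simp: r_interior_def)
    moreover have "- (u i \<bullet> x) \<le> norm x"
      using norm_cauchy_schwarz[of "- u i" x] norm_u[OF i] by simp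
    ultimately show False using r by simp
  qed
  then show ?thesis by (intro exI[of _ "max 0 (\<beta> i + B + 1)"]) auto
qed

lemma diphase_smooth_imp_inscribed:
  assumes "steiner_like_with DIM('a) 2 g \<kappa> (inner_nbhd_volume P)"
    and Ck: "Ck_on (DIM('a) - 1) (inner_nbhd_volume P) {0..}"
  shows "\<exists>c. inscribed_ball P c (g 1)"
proof (rule inscribed_ball_of_power_volume)
  let ?V = "inner_nbhd_volume P" and ?d = "DIM('a)" and ?v = "measure lebesgue P"
  have "g 0 = 0" "g 0 < g 1" and left: "\<And>r. r \<in> {0..g 1} \<Longrightarrow> ?V r = (\<Sum>k\<le>?d. \<kappa> (?d - k) 1 * r ^ k)"
    using assms(1) by (auto simp: steiner_like_with_def)
  then show g: "0 < g 1" by simp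
  obtain e where right: "\<And>r. g 1 \<le> r \<Longrightarrow> ?V r = e"
    using assms(1) by (auto simp: steiner_like_with_def)
  define p where "p = (\<Sum>k\<le>?d. monom (\<kappa> (?d - k) 1) k)"
  have "degree p \<le> ?d"
    unfolding p_def by (intro degree_sum_le) (auto intro: order_trans[OF degree_monom_le])
  moreover have "?V r = poly p r" if "r \<in> {0..g 1}" for r
    using left[OF that] by (simp add: p_def poly_sum poly_monom)
  ultimately obtain \<alpha> where \<alpha>: "\<And>r. r \<in> {0..g 1} \<Longrightarrow> ?V r = e + \<alpha> * (r - g 1) ^ ?d"
    using smooth_gluing_to_constant[OF _ DIM_positive g _ right Ck] by blast
  obtain R where "\<And>r. r \<ge> R \<Longrightarrow> r_interior P r = {}"
    using r_interior_eventually_empty by blast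
  then have e: "e = ?v"
    using right[of "max R (g 1)"] by (simp add: inner_nbhd_volume_eq)
  have "?V 0 = 0"
    by (simp add: inner_nbhd_volume_eq r_interior_0)
  then have \<alpha>v: "\<alpha> * (- g 1) ^ ?d = - ?v"
    using \<alpha>[of 0] g e by simp
  fix r assume r: "0 \<le> r" "r \<le> g 1"
  have "r - g 1 = (- g 1) * (1 - r / g 1)"
    using g by (simp add: field_simps)
  then have "\<alpha> * (r - g 1) ^ ?d = (\<alpha> * (- g 1) ^ ?d) * (1 - r / g 1) ^ ?d"
    by (simp only: power_mult_distrib mult.assoc)
  then have "\<alpha> * (r - g 1) ^ ?d = - ?v * (1 - r / g 1) ^ ?d"
    unfolding \<alpha>v .
  then show "?V r = ?v - ?v * (1 - r / g 1) ^ ?d"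
    using \<alpha>[of r] r e by simp
qed

end

section \<open>Coefficients of the volume function\<close>

text \<open>The value 0 at \<open>i = d\<close> makes this also the coefficient of \<open>r\<^sup>0\<close>, reflecting \<open>V\<^sub>P(0) = 0\<close>.\<close>

definition ball_coefficient :: "nat \<Rightarrow> real \<Rightarrow> real \<Rightarrow> nat \<Rightarrow> real" where
  "ball_coefficient d v \<rho> i =
     (if i < d then (-1) ^ (d - i - 1) * real (d choose i) * v / \<rho> ^ (d - i) else 0)"

lemma power_volume_expansion:
  "v - v * (1 - r / \<rho>) ^ d = (\<Sum>k\<le>d. ball_coefficient d v \<rho> (d - k) * r ^ k)"
proof -
  have "(1 - r / \<rho>) ^ d = (\<Sum>k\<le>d. real (d choose k) * (- (r / \<rho>)) ^ k)"
    using binomial_ring[of "- (r / \<rho>)" 1 d] by simp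
  also have "\<dots> = 1 + (\<Sum>k=1..d. real (d choose k) * (- (r / \<rho>)) ^ k)"
    by (simp add: atMost_atLeast0 sum.atLeast_Suc_atMost)
  finally have "v - v * (1 - r / \<rho>) ^ d = (\<Sum>k=1..d. - v * (real (d choose k) * (- (r / \<rho>)) ^ k))"
    by (simp add: distrib_left sum_distrib_left sum_negf)
  also have "\<dots> = (\<Sum>k=1..d. ball_coefficient d v \<rho> (d - k) * r ^ k)"
  proof (rule sum.cong)
    fix k assume k: "k \<in> {1..d}"
    then obtain j where j: "k = Suc j" by (cases k) auto
    have "(- (r / \<rho>)) ^ k = (-1) ^ k * (r ^ k / \<rho> ^ k)"
      by (metis mult_minus1 power_divide power_mult_distrib)
    moreover have "real (d choose k) = real (d choose (d - k))"
      using k by (metis atLeastAtMost_iff binomial_symmetric)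
    ultimately show "- v * (real (d choose k) * (- (r / \<rho>)) ^ k) = ball_coefficient d v \<rho> (d - k) * r ^ k"
      using k by (simp add: ball_coefficient_def j)
  qed simp
  also have "\<dots> = (\<Sum>k\<le>d. ball_coefficient d v \<rho> (d - k) * r ^ k)"
    by (rule sum.mono_neutral_left) (auto simp: ball_coefficient_def)
  finally show ?thesis .
qed

lemma polyfun_coeff_eq_on_infinite:
  fixes a b :: "nat \<Rightarrow> real"
  assumes "infinite S" "\<And>r. r \<in> S \<Longrightarrow> (\<Sum>k\<le>n. a k * r ^ k) = (\<Sum>k\<le>n. b k * r ^ k)" "k \<le> n"
  shows "a k = b k"
proof -
  have "S \<subseteq> {r. (\<Sum>k\<le>n. (a k - b k) * r ^ k) = 0}"
    using assms(2) by (auto simp: left_diff_distrib sum_subtractf)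
  then have "infinite {r. (\<Sum>k\<le>n. (a k - b k) * r ^ k) = 0}"
    using assms(1) finite_subset by blast
  then show ?thesis
    using polyfun_finite_roots[of "\<lambda>k. a k - b k" n] assms(3) by auto
qed

context unit_normal_presentation
begin

lemma inscribed_imp_steiner_like:
  assumes "inscribed_ball P c \<rho>"
  shows "steiner_like_with DIM('a) 2 (\<lambda>i. if i = 0 then 0 else \<rho>)
           (\<lambda>i _. ball_coefficient DIM('a) (measure lebesgue P) \<rho> i) (inner_nbhd_volume P)"
proof -
  let ?V = "inner_nbhd_volume P" and ?d = "DIM('a)" and ?v = "measure lebesgue P"
  have \<rho>: "0 < \<rho>" using assms by (simp add: inscribed_ball_def)
  note V = volume_of_inscribed[OF assms]
  have "continuous_on {0..} (\<lambda>r. ?v - ?v * max 0 (1 - r / \<rho>) ^ ?d)"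
    using \<rho> by (intro continuous_intros) simp_all
  then have "continuous_on {0..} ?V"
    by (rule continuous_on_eq) (simp add: V)
  moreover have "?V r = (\<Sum>k\<le>?d. ball_coefficient ?d ?v \<rho> (?d - k) * r ^ k)" if "0 \<le> r" "r \<le> \<rho>" for r
    using V[OF that(1)] that \<rho> by (simp add: power_volume_expansion[symmetric] max_absorb2)
  moreover have "?V r = ?v" if "\<rho> \<le> r" for r
  proof -
    have "max 0 (1 - r / \<rho>) = 0" using that \<rho> by simp
    then show ?thesis using V[of r] that \<rho> by simp
  qed
  ultimately show ?thesis
    using \<rho> by (auto simp: steiner_like_with_def inner_nbhd_volume_def)
qed

text \<open>A diphase representation may have any break point \<open>g 1\<close>, but its polynomial and the one found above
  agree on a common interval to the right of 0, so they have the same coefficients.\<close>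

lemma inscribed_imp_coefficients:
  assumes "inscribed_ball P c \<rho>"
    and steiner: "steiner_like_with DIM('a) 2 g \<kappa> (inner_nbhd_volume P)"
    and i: "i < DIM('a)"
  shows "\<kappa> i 1 = ball_coefficient DIM('a) (measure lebesgue P) \<rho> i"
proof -
  let ?V = "inner_nbhd_volume P" and ?d = "DIM('a)" and ?v = "measure lebesgue P"
  have "0 < \<rho>" using assms by (simp add: inscribed_ball_def)
  moreover have "0 < g 1" and 1: "\<And>r. r \<in> {0..g 1} \<Longrightarrow> ?V r = (\<Sum>k\<le>?d. \<kappa> (?d - k) 1 * r ^ k)"
    using steiner by (auto simp: steiner_like_with_def)
  moreover have 2: "\<And>r. r \<in> {0..\<rho>} \<Longrightarrow> ?V r = (\<Sum>k\<le>?d. ball_coefficient ?d ?v \<rho> (?d - k) * r ^ k)"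
    using inscribed_imp_steiner_like[OF assms(1)] by (auto simp: steiner_like_with_def)
  ultimately have "infinite {0..min (g 1) \<rho>}"
    by (simp add: infinite_Icc)
  then have "\<kappa> (?d - (?d - i)) 1 = ball_coefficient ?d ?v \<rho> (?d - (?d - i))"
    by (rule polyfun_coeff_eq_on_infinite[where n = ?d and a = "\<lambda>k. \<kappa> (?d - k) 1"
          and b = "\<lambda>k. ball_coefficient ?d ?v \<rho> (?d - k)"])
      (use 1 2 in \<open>auto simp flip: 1 2\<close>)
  then show ?thesis using i by simp
qed

end

theorem theorem1:
  fixes P :: "'a::euclidean_space set"
  assumes "full_polytope P"
  shows "((diphase_steiner_like DIM('a) (inner_nbhd_volume P) \<and>
           Ck_on (DIM('a) - 1) (inner_nbhd_volume P) {0..})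
            \<longleftrightarrow> (\<exists>c \<rho>. inscribed_ball P c \<rho>)) \<and>
         ((\<exists>c \<rho>. inscribed_ball P c \<rho>) \<longrightarrow>
          (\<forall>g \<kappa>. steiner_like_with DIM('a) 2 g \<kappa> (inner_nbhd_volume P) \<longrightarrow>
            (\<forall>i<DIM('a). \<kappa> i 1 = (-1) ^ (DIM('a) - i - 1) * real (DIM('a) choose i)
                                 * measure lebesgue P / inradius P ^ (DIM('a) - i))))"
proof -
  obtain Hs :: "'a set set" and u \<beta> where "unit_normal_presentation P Hs u \<beta>"
    using full_polytope_unit_normal_presentation[OF assms] by blast
  then interpret unit_normal_presentation P Hs u \<beta> .
  show ?thesis
  proof (intro conjI iffI impI allI)
    assume "diphase_steiner_like DIM('a) (inner_nbhd_volume P) \<and>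
           Ck_on (DIM('a) - 1) (inner_nbhd_volume P) {0..}"
    then show "\<exists>c \<rho>. inscribed_ball P c \<rho>"
      using diphase_smooth_imp_inscribed unfolding diphase_steiner_like_def by blast
  next
    assume "\<exists>c \<rho>. inscribed_ball P c \<rho>"
    then obtain c \<rho> where ball: "inscribed_ball P c \<rho>" by blast
    then show "diphase_steiner_like DIM('a) (inner_nbhd_volume P)"
      using inscribed_imp_steiner_like unfolding diphase_steiner_like_def by blast
    show "Ck_on (DIM('a) - 1) (inner_nbhd_volume P) {0..}"
      using ball volume_of_inscribed[OF ball]
      by (intro truncated_power_Ck[of \<rho>]) (auto simp: inscribed_ball_def)
  next
    fix g \<kappa> i
    assume "\<exists>c \<rho>. inscribed_ball P c \<rho>"
      and steiner: "steiner_like_with DIM('a) 2 g \<kappa> (inner_nbhd_volume P)" and i: "i < DIM('a)"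
    then obtain c \<rho> where ball: "inscribed_ball P c \<rho>" by blast
    show "\<kappa> i 1 = (-1) ^ (DIM('a) - i - 1) * real (DIM('a) choose i)
            * measure lebesgue P / inradius P ^ (DIM('a) - i)"
      using inscribed_imp_coefficients[OF ball steiner i] i
      by (simp add: ball_coefficient_def inradius_inscribed[OF ball])
  qed
qed

end
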